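(* Let $n>2$ be a real number, let $R>0$, put $q=\frac{n+2}{n-2}$, let $\omega\ge 0$, and let $a\in C^3[0,R]$ be a real-valued function such that (i) $a(0)=0$; (ii) $a'(x)>0$ for all $x\in(0,R)$; (iii) $a''(x)\ge \omega\, a(x)$ for all $x\in(0,R)$. Define $$D=\inf_{0<x<R}\left\{(2n-3)\frac{a''(x)}{a(x)}+\frac{a'''(x)}{a'(x)}\right\},\qquad C=\min\left\{\frac{D+2\omega}{2(n+2)},\frac{D}{4}\right\}.$$ Let $\lambda\in\mathbb{R}$ satisfy $$\lambda\le\lambda^*(n,R):=\frac{n(n-1)}{4}\,C.$$ Then the boundary value problem $$\begin{cases}-u''(x)-(n-1)\dfrac{a'(x)}{a(x)}u'(x)=\lambda u(x)+|u(x)|^{q-1}u(x),\\ u'(0)=u(R)=0,\end{cases}$$ has no non-trivial solution $u\in C^2[0,R]$.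
   Context: A solution is a real-valued function $u\in C^2[0,R]$ satisfying the differential equation for $x\in(0,R)$ together with the boundary conditions $u'(0)=0$ and $u(R)=0$; it is non-trivial if it is not identically zero. The infimum is taken in the extended reals (if it equals $-\infty$, then $C=-\infty$ and the condition on $\lambda$ is never satisfied). *)

theory Defs
  imports "HOL-Analysis.Analysis"
begin

text \<open>Derivatives on \<open>[0,R]\<close> are taken relative to the interval: two-sided in the interior,
  one-sided at the endpoints. They depend only on the values of the function on \<open>[0,R]\<close>.\<close>

definition nth_deriv_on :: "real set \<Rightarrow> nat \<Rightarrow> (real \<Rightarrow> real) \<Rightarrow> real \<Rightarrow> real" where
  "nth_deriv_on S k f = ((\<lambda>g x. vector_derivative g (at x within S)) ^^ k) f"

definition C_k_on :: "nat \<Rightarrow> real set \<Rightarrow> (real \<Rightarrow> real) \<Rightarrow> bool" where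
  "C_k_on k S f \<longleftrightarrow>
     (\<forall>j<k. nth_deriv_on S j f differentiable_on S) \<and>
     (\<forall>j\<le>k. continuous_on S (nth_deriv_on S j f))"

definition D_inf :: "real \<Rightarrow> real \<Rightarrow> (real \<Rightarrow> real) \<Rightarrow> ereal" where
  "D_inf n R a = (INF x\<in>{0<..<R}. ereal
     ((2 * n - 3) * (nth_deriv_on {0..R} 2 a x / a x)
       + nth_deriv_on {0..R} 3 a x / nth_deriv_on {0..R} 1 a x))"

definition C_min :: "real \<Rightarrow> real \<Rightarrow> real \<Rightarrow> (real \<Rightarrow> real) \<Rightarrow> ereal" where
  "C_min n R \<omega> a =
     min ((D_inf n R a + ereal (2 * \<omega>)) / ereal (2 * (n + 2))) (D_inf n R a / 4)"

definition lambda_star :: "real \<Rightarrow> real \<Rightarrow> real \<Rightarrow> (real \<Rightarrow> real) \<Rightarrow> ereal" where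
  "lambda_star n R \<omega> a = ereal (n * (n - 1) / 4) * C_min n R \<omega> a"

text \<open>In \<open>bvp_solution\<close>, \<open>0 powr (q - 1) = 0\<close> agrees with the usual convention since \<open>q > 1\<close>.\<close>

definition bvp_solution ::
  "real \<Rightarrow> real \<Rightarrow> real \<Rightarrow> (real \<Rightarrow> real) \<Rightarrow> real \<Rightarrow> (real \<Rightarrow> real) \<Rightarrow> bool" where
  "bvp_solution n R q a lam u \<longleftrightarrow>
     C_k_on 2 {0..R} u \<and>
     (\<forall>x\<in>{0<..<R}.
        - nth_deriv_on {0..R} 2 u x
          - (n - 1) * (nth_deriv_on {0..R} 1 a x / a x) * nth_deriv_on {0..R} 1 u x
        = lam * u x + \<bar>u x\<bar> powr (q - 1) * u x) \<and>
     nth_deriv_on {0..R} 1 u 0 = 0 \<and> u R = 0"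

end

theory Submission
  imports Defs
begin

text \<open>
  Write \<open>b = a'/a\<close> and \<open>p = 2n/(n-2)\<close>. Integrating
  \<open>(a\<^sup>2\<^sup>n\<^sup>-\<^sup>3 a'')' \<ge> D a\<^sup>2\<^sup>n\<^sup>-\<^sup>3 a'\<close> reduces the hypotheses to \<open>a'' \<ge> w a\<close> with
  \<open>w = max \<omega> (D/(2n-2))\<close> and \<open>\<lambda> \<le> n\<^sup>2(n-1)w / (4(n+2))\<close>. The energy
  \<open>u'\<^sup>2/2 + \<lambda>u\<^sup>2/2 + |u|\<^sup>p/p\<close> decreases, so \<open>u(0) \<noteq> 0\<close>, and if \<open>u(0) > 0\<close> then \<open>u\<close>
  decreases up to its first zero.

  For a weight \<open>A(x)\<close> consider the Pohozaev-type function
  \<open>\<Phi> = u'\<^sup>2/2 + A u u' + (\<lambda>u\<^sup>2 + |u|\<^sup>p)/p\<close>; \<open>a\<^sup>n \<Phi>\<close> vanishes at \<open>0\<close>.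
  With \<open>A = (n-2)b/2\<close> it is nonincreasing if \<open>\<lambda> \<le> n(n-2)w/4\<close>, although \<open>\<Phi> > 0\<close> at the first zero;
  this settles \<open>\<lambda> \<le> 0\<close> and \<open>n \<ge> 4\<close>. Otherwise let \<open>T = (n-2)b + K\<close> be a supersolution of
  the Riccati equation of the linear problem that blows up at \<open>0\<close> like the logarithmic derivative
  of its Green function, and \<open>A = (T + \<sigma>/T)/2\<close> with \<open>\<sigma> = 2\<lambda>/p\<close>, so that
  \<open>\<Phi> = (u' + T u)(u' + \<sigma>u/T)/2 + |u|\<^sup>p/p\<close>. Up to the first point
  where \<open>u' + T u \<le> 0\<close>, \<open>a\<^sup>n \<Phi>\<close> cannot increase while positive, but \<open>\<Phi> > 0\<close> at that point.
\<close>

subsection \<open>One-variable calculus\<close>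

text \<open>The form \<open>\<bar>x\<bar> powr (p - 2) * x\<close> serves both signs and is the
  nonlinearity of the equation. At 0 its value is 0 through the factor \<open>x\<close>, and the
  difference quotient is of size \<open>\<bar>h\<bar> powr (p - 1)\<close>.\<close>

lemma has_real_derivative_abs_powr:
  fixes p x :: real
  assumes "p > 1"
  shows "((\<lambda>x. \<bar>x\<bar> powr p) has_real_derivative p * (\<bar>x\<bar> powr (p - 2) * x)) (at x)"
proof -
  consider "x > 0" | "x < 0" | "x = 0" by linarith
  then show ?thesis
  proof cases
    case 1
    have "((\<lambda>x. x powr p) has_real_derivative p * x powr (p - 1)) (at x)"
      using 1 by (auto intro!: derivative_eq_intros)
    moreover have "x powr (p - 1) = \<bar>x\<bar> powr (p - 2) * x"
      using 1 powr_add[of x "p - 2" 1] by simp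
    moreover have "eventually (\<lambda>y. y powr p = \<bar>y\<bar> powr p) (nhds x)"
      by (rule eventually_mono[OF eventually_nhds_in_open[of "{0<..}"]]) (use 1 in auto)
    ultimately show ?thesis using DERIV_cong_ev[OF refl, of "\<lambda>y. y powr p" "\<lambda>y. \<bar>y\<bar> powr p" x] by simp
  next
    case 2
    have "((\<lambda>x. (-x) powr p) has_real_derivative - (p * (-x) powr (p - 1))) (at x)"
      using 2 by (auto intro!: derivative_eq_intros)
    moreover have "- ((-x) powr (p - 1)) = \<bar>x\<bar> powr (p - 2) * x"
      using 2 powr_add[of "-x" "p - 2" 1] by simp
    moreover have "eventually (\<lambda>y. (-y) powr p = \<bar>y\<bar> powr p) (nhds x)"
      by (rule eventually_mono[OF eventually_nhds_in_open[of "{..<0}"]]) (use 2 in auto)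
    ultimately show ?thesis
      using DERIV_cong_ev[OF refl, of "\<lambda>y. (-y) powr p" "\<lambda>y. \<bar>y\<bar> powr p" x]
      by (metis mult_minus_right)
  next
    case 3
    have "((\<lambda>h::real. \<bar>h\<bar> powr (p - 1)) \<longlongrightarrow> \<bar>0\<bar> powr (p - 1)) (at 0)"
      using assms by (intro tendsto_intros) auto
    then have "((\<lambda>h::real. \<bar>h\<bar> powr (p - 1)) \<longlongrightarrow> 0) (at 0)"
      by simp
    then have "((\<lambda>h::real. \<bar>h\<bar> powr p / h) \<longlongrightarrow> 0) (at 0)"
    proof (rule Lim_null_comparison[rotated])
      have "norm (\<bar>h\<bar> powr p / h) \<le> \<bar>h\<bar> powr (p - 1)" for h :: real
        using powr_diff[of "\<bar>h\<bar>" p 1] by (cases "h = 0") (auto simp: abs_mult)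
      then show "\<forall>\<^sub>F h::real in at 0. norm (\<bar>h\<bar> powr p / h) \<le> \<bar>h\<bar> powr (p - 1)"
        by simp
    qed
    then show ?thesis using 3 assms by (simp add: DERIV_def)
  qed
qed

lemma continuous_on_abs_powr:
  fixes f :: "'a::topological_space \<Rightarrow> real"
  assumes "continuous_on S f" "e > 0"
  shows "continuous_on S (\<lambda>x. \<bar>f x\<bar> powr e)"
  using assms by (intro continuous_on_powr' continuous_on_rabs continuous_on_const) auto

lemma abs_powr_eq_mult_square:
  fixes y p :: real
  shows "\<bar>y\<bar> powr p = \<bar>y\<bar> powr (p - 2) * y\<^sup>2"
  using powr_add[of "\<bar>y\<bar>" "p - 2" 2] by (cases "y = 0") simp_all

section \<open>Level crossings and comparison arguments on an interval\<close>

lemma compact_sublevel: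
  fixes f :: "real \<Rightarrow> real"
  assumes "continuous_on {x..y} f"
  shows "compact ({x..y} \<inter> f -` {..c})"
proof -
  have "closed ({x..y} \<inter> f -` {..c})"
    by (rule continuous_closed_preimage[OF assms]) simp_all
  then show ?thesis
    using bounded_subset[OF bounded_closed_interval Int_lower1]
    by (simp add: compact_eq_bounded_closed)
qed

lemma last_sublevel_point:
  fixes f :: "real \<Rightarrow> real"
  assumes "continuous_on {x..y} f" "x \<le> y" "f x \<le> c"
  obtains z where "x \<le> z" "z \<le> y" "f z \<le> c" "\<And>t. z < t \<Longrightarrow> t \<le> y \<Longrightarrow> f t > c"
proof -
  have "x \<in> {x..y} \<inter> f -` {..c}" using assms by simp
  then obtain z where z: "z \<in> {x..y} \<inter> f -` {..c}"
      "\<forall>t \<in> {x..y} \<inter> f -` {..c}. t \<le> z"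
    using compact_attains_sup[OF compact_sublevel[OF assms(1), of c]] by (metis empty_iff)
  have "f t > c" if "z < t" "t \<le> y" for t
    using z(2)[rule_format, of t] that z(1) by (cases "f t \<le> c") auto
  with that[of z] z(1) show ?thesis by simp
qed

lemma first_sublevel_point:
  fixes f :: "real \<Rightarrow> real"
  assumes "continuous_on {x..y} f" "x \<le> y" "f y \<le> c"
  obtains z where "x \<le> z" "z \<le> y" "f z \<le> c" "\<And>t. x \<le> t \<Longrightarrow> t < z \<Longrightarrow> f t > c"
proof -
  have "y \<in> {x..y} \<inter> f -` {..c}" using assms by simp
  then obtain z where z: "z \<in> {x..y} \<inter> f -` {..c}"
      "\<forall>t \<in> {x..y} \<inter> f -` {..c}. z \<le> t"
    using compact_attains_inf[OF compact_sublevel[OF assms(1), of c]] by (metis empty_iff)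
  have "f t > c" if "x \<le> t" "t < z" for t
    using z(2)[rule_format, of t] that z(1) by (cases "f t \<le> c") auto
  with that[of z] z(1) show ?thesis by simp
qed

text \<open>After the last point where \<open>f\<close> is at or below a positive level,
  \<open>f\<close> is positive and hence nonincreasing, so it cannot end above that level.\<close>

lemma nonincreasing_where_pos:
  fixes f f' :: "real \<Rightarrow> real"
  assumes "x \<le> y" and cont: "continuous_on {x..y} f"
    and der: "\<And>z. x < z \<Longrightarrow> z < y \<Longrightarrow> (f has_real_derivative f' z) (at z)"
    and nonpos: "\<And>z. x < z \<Longrightarrow> z < y \<Longrightarrow> f z > 0 \<Longrightarrow> f' z \<le> 0"
    and "f y > 0"
  shows "f y \<le> f x"
proof (rule ccontr)
  assume less: "\<not> f y \<le> f x"
  \<comment> \<open>Any positive level in \<open>[f x, f y)\<close> would do; \<open>f y / 2\<close>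
    supplies one when \<open>f x\<close> is not positive.\<close>
  define c where "c = max (f x) (f y / 2)"
  have c: "c < f y" "c > 0" "f x \<le> c" using less \<open>f y > 0\<close> by (auto simp: c_def)
  obtain z where z: "x \<le> z" "z \<le> y" "f z \<le> c" "\<And>t. z < t \<Longrightarrow> t \<le> y \<Longrightarrow> f t > c"
    using last_sublevel_point[OF cont \<open>x \<le> y\<close> c(3)] by metis
  have "f y \<le> f z"
  proof (rule DERIV_nonpos_imp_decreasing_open[OF z(2)])
    show "\<exists>d. (f has_real_derivative d) (at t) \<and> d \<le> 0" if "z < t" "t < y" for t
      using der[of t] nonpos[of t] z(4)[of t] c(2) that z(1) by fastforce
    show "continuous_on {z..y} f"
      by (rule continuous_on_subset[OF cont]) (use z(1) in auto)
  qed
  then show False using c z(3) by linarith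
qed

text \<open>The majorant \<open>g\<close> stands in for continuity of \<open>f\<close> at 0, since
  the weights used later may blow up there. A positive \<open>f c\<close> would bound
  \<open>f\<close>, and thus \<open>g\<close>, below by \<open>f c\<close> on all of
  \<open>(0,c)\<close>, against \<open>g 0 = 0\<close>.\<close>

lemma nonpos_from_zero:
  fixes f f' g :: "real \<Rightarrow> real"
  assumes "0 < c" and cont: "continuous_on {0<..c} f"
    and der: "\<And>z. 0 < z \<Longrightarrow> z < c \<Longrightarrow> (f has_real_derivative f' z) (at z)"
    and nonpos: "\<And>z. 0 < z \<Longrightarrow> z < c \<Longrightarrow> f z > 0 \<Longrightarrow> f' z \<le> 0"
    and le: "\<And>z. 0 < z \<Longrightarrow> z \<le> c \<Longrightarrow> f z \<le> g z"
    and g: "continuous_on {0..c} g" "g 0 = 0"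
  shows "f c \<le> 0"
proof (rule ccontr)
  assume "\<not> f c \<le> 0"
  then have pos: "f c > 0" by simp
  have "f c \<le> g x" if x: "x \<in> {0<..<c}" for x
  proof -
    have "f c \<le> f x"
    proof (rule nonincreasing_where_pos[where f = f and f' = f'])
      show "continuous_on {x..c} f"
        by (rule continuous_on_subset[OF cont]) (use x in auto)
      show "(f has_real_derivative f' z) (at z)" if "x < z" "z < c" for z
        using der[of z] that x by simp
      show "f' z \<le> 0" if "x < z" "z < c" "f z > 0" for z
        using nonpos[of z] that x by simp
    qed (use x pos in simp_all)
    then show ?thesis using le[of x] x by simp
  qed
  have "(g \<longlongrightarrow> 0) (at_right 0)"
    using continuous_on_Icc_at_rightD[OF g(1) \<open>0 < c\<close>] g(2) by simp
  moreover have "eventually (\<lambda>x. f c \<le> g x) (at_right 0)"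
    by (rule eventually_mono[OF eventually_at_right_real[OF \<open>0 < c\<close>]]) fact
  ultimately have "f c \<le> 0"
    by (rule tendsto_lowerbound) simp
  then show False using pos by simp
qed

text \<open>Gronwall's argument run backwards: with the integrating factor,
  \<open>Y z * exp (K * z)\<close> is nondecreasing.\<close>

lemma nonpos_of_zero_at_right_end:
  fixes Y Y' :: "real \<Rightarrow> real"
  assumes "x < y" "continuous_on {x..y} Y"
    and "\<And>z. x < z \<Longrightarrow> z < y \<Longrightarrow> (Y has_real_derivative Y' z) (at z)"
    and "\<And>z. x < z \<Longrightarrow> z < y \<Longrightarrow> Y' z \<ge> - K * Y z"
    and "Y y = 0"
  shows "Y x \<le> 0"
proof -
  have "Y x * exp (K * x) \<le> Y y * exp (K * y)"
  proof (rule DERIV_nonneg_imp_increasing_open[of x y "\<lambda>z. Y z * exp (K * z)"])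
    show "\<exists>d. ((\<lambda>z. Y z * exp (K * z)) has_real_derivative d) (at z) \<and> 0 \<le> d"
      if "x < z" "z < y" for z
    proof (intro exI conjI)
      show "((\<lambda>z. Y z * exp (K * z)) has_real_derivative (Y' z + K * Y z) * exp (K * z)) (at z)"
        by (auto intro!: derivative_eq_intros assms(3) that simp: algebra_simps)
      show "0 \<le> (Y' z + K * Y z) * exp (K * z)" using assms(4)[OF that] by simp
    qed
  qed (use assms(1,2) in \<open>auto intro!: continuous_intros\<close>)
  then show ?thesis using assms(5) exp_gt_zero[of "K * x"] by (simp add: mult_le_0_iff del: exp_gt_zero)
qed

subsection \<open>Energy and monotonicity\<close>

text \<open>Here \<open>p\<close> equals \<open>q + 1\<close>, the critical Sobolev exponent in
  dimension \<open>n\<close>, and \<open>ode\<close> is the equation solved for \<open>u2\<close>.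
  Derivatives are separate functions, which keeps the analysis free of
  \<open>nth_deriv_on\<close>.\<close>

locale radial_bvp =
  fixes n R lam p :: real and a a1 a2 u u1 u2 :: "real \<Rightarrow> real"
  assumes n: "n > 2" and R: "R > 0" and p: "p = 2 * n / (n - 2)"
    and cont: "continuous_on {0..R} a" "continuous_on {0..R} a1"
      "continuous_on {0..R} u" "continuous_on {0..R} u1"
    and a_deriv: "\<And>x. 0 < x \<Longrightarrow> x < R \<Longrightarrow> (a has_real_derivative a1 x) (at x)"
    and a1_deriv: "\<And>x. 0 < x \<Longrightarrow> x < R \<Longrightarrow> (a1 has_real_derivative a2 x) (at x)"
    and u_deriv: "\<And>x. 0 < x \<Longrightarrow> x < R \<Longrightarrow> (u has_real_derivative u1 x) (at x)"
    and u1_deriv: "\<And>x. 0 < x \<Longrightarrow> x < R \<Longrightarrow> (u1 has_real_derivative u2 x) (at x)"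
    and a_0: "a 0 = 0"
    and a1_pos: "\<And>x. 0 < x \<Longrightarrow> x < R \<Longrightarrow> a1 x > 0"
    and ode: "\<And>x. 0 < x \<Longrightarrow> x < R \<Longrightarrow>
      u2 x = - (n - 1) * (a1 x / a x) * u1 x - u x * (lam + \<bar>u x\<bar> powr (p - 2))"
    and u1_0: "u1 0 = 0" and u_R: "u R = 0"
begin

lemma p_gt_2: "p > 2"
  using n by (simp add: p field_simps)

lemma cont_sub:
  assumes "S \<subseteq> {0..R}"
  shows "continuous_on S a" "continuous_on S a1" "continuous_on S u" "continuous_on S u1"
  using cont assms continuous_on_subset by blast+

lemma a_pos:
  assumes "0 < x" "x \<le> R"
  shows "a x > 0"
proof -
  have "a 0 < a x"
    by (rule DERIV_pos_imp_increasing_open[OF assms(1)])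
      (use assms a_deriv a1_pos in \<open>force intro: continuous_on_subset[OF cont(1)]\<close>)+
  then show ?thesis by (simp add: a_0)
qed

lemma a_nonneg: "0 \<le> x \<Longrightarrow> x \<le> R \<Longrightarrow> a x \<ge> 0"
  using a_pos a_0 by (cases "x = 0") (auto simp: less_imp_le)

definition energy :: "real \<Rightarrow> real" where
  "energy x = (u1 x)\<^sup>2 / 2 + lam * (u x)\<^sup>2 / 2 + \<bar>u x\<bar> powr p / p"

lemma energy_deriv:
  assumes "0 < x" "x < R"
  shows "(energy has_real_derivative - (n - 1) * (a1 x / a x) * (u1 x)\<^sup>2) (at x)"
proof -
  have "((\<lambda>x. \<bar>u x\<bar> powr p) has_real_derivative p * (\<bar>u x\<bar> powr (p - 2) * u x) * u1 x) (at x)"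
    using DERIV_chain2[OF has_real_derivative_abs_powr u_deriv[OF assms]] p_gt_2 by simp
  then have "((\<lambda>x. (u1 x)\<^sup>2 / 2 + lam * (u x)\<^sup>2 / 2 + \<bar>u x\<bar> powr p / p) has_real_derivative
      u1 x * u2 x + lam * u x * u1 x + p * (\<bar>u x\<bar> powr (p - 2) * u x) * u1 x / p) (at x)"
    by (rule DERIV_cong[OF DERIV_add[OF DERIV_add[OF
          DERIV_cdivide[OF DERIV_power[OF u1_deriv[OF assms], where n = 2]]
          DERIV_cdivide[OF DERIV_cmult[OF DERIV_power[OF u_deriv[OF assms], where n = 2]]]]
          DERIV_cdivide]]) (simp add: algebra_simps)
  moreover have "u1 x * u2 x + lam * u x * u1 x + p * (\<bar>u x\<bar> powr (p - 2) * u x) * u1 x / p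
      = - (n - 1) * (a1 x / a x) * (u1 x)\<^sup>2"
    using p_gt_2 by (simp add: ode[OF assms] power2_eq_square) (simp add: algebra_simps)
  ultimately show ?thesis unfolding energy_def by simp
qed

lemma energy_cont: "continuous_on {0..R} energy"
  unfolding energy_def using p_gt_2
  by (auto intro!: continuous_intros continuous_on_abs_powr cont)

lemma energy_antimono:
  assumes "0 \<le> x" "x \<le> y" "y \<le> R"
  shows "energy y \<le> energy x"
proof (rule DERIV_nonpos_imp_decreasing_open[OF assms(2)])
  show "\<exists>d. (energy has_real_derivative d) (at z) \<and> d \<le> 0" if "x < z" "z < y" for z
  proof (intro exI conjI)
    have z: "0 < z" "z < R" using that assms by auto
    then show "(energy has_real_derivative - (n - 1) * (a1 z / a z) * (u1 z)\<^sup>2) (at z)"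
      by (rule energy_deriv)
    have "(n - 1) * (a1 z / a z) * (u1 z)\<^sup>2 \<ge> 0"
      using a_pos[of z] a1_pos[of z] n z by simp
    then show "- (n - 1) * (a1 z / a z) * (u1 z)\<^sup>2 \<le> 0"
      by (simp only: mult_minus_left neg_le_0_iff_le)
  qed
  show "continuous_on {x..y} energy"
    using assms by (intro continuous_on_subset[OF energy_cont]) auto
qed

text \<open>At \<open>R\<close> only \<open>(u1 R)\<^sup>2 / 2\<close> is left, and the energy
  decreases towards that value.\<close>

lemma energy_nonneg:
  assumes "0 \<le> x" "x \<le> R"
  shows "energy x \<ge> 0"
proof -
  have "energy R \<ge> 0" using p_gt_2 by (simp add: energy_def u_R)
  with energy_antimono[of x R] assms show ?thesis by simp
qed

text \<open>The energy starts at 0, never increases and stays nonnegative, so it is identically 0;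
  its dissipation rate then forces \<open>u1 = 0\<close> in the interior.\<close>

lemma trivial_if_zero_at_origin:
  assumes "u 0 = 0" "x \<in> {0..R}"
  shows "u x = 0"
proof -
  have E0: "energy y = 0" if "0 \<le> y" "y \<le> R" for y
    using energy_antimono[of 0 y] energy_nonneg[of y] that assms
    by (simp add: energy_def[of 0] u1_0)
  have u1: "u1 y = 0" if "0 < y" "y < R" for y
  proof -
    have "(energy has_real_derivative 0) (at y)"
    proof (rule has_field_derivative_transform_within_open)
      show "((\<lambda>_. 0) has_real_derivative 0) (at y)" by simp
    qed (use that E0 in \<open>auto intro: open_greaterThanLessThan[of 0 R]\<close>)
    then have "- (n - 1) * (a1 y / a y) * (u1 y)\<^sup>2 = 0"
      using energy_deriv[OF that] DERIV_unique by blast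
    then show ?thesis using n a_pos[of y] a1_pos[of y] that by auto
  qed
  have "u x = u R" if "x < R"
  proof (rule DERIV_isconst_end[OF that, symmetric])
    show "continuous_on {x..R} u" by (rule cont_sub) (use assms(2) in auto)
    show "(u has_real_derivative 0) (at y)" if "x < y" "y < R" for y
      using u_deriv[of y] u1[of y] that assms(2) by simp
  qed
  then show ?thesis using u_R assms(2) by (cases "x = R") auto
qed

text \<open>Nonnegative energy with \<open>u1 x = 0\<close> gives
  \<open>lam / 2 + U / p \<ge> 0\<close> for the power term \<open>U\<close>; since
  \<open>p > 2\<close>, replacing \<open>U / p\<close> by \<open>U / 2\<close> makes this strict.
  The content lies in negative \<open>lam\<close>.\<close>

lemma reaction_pos_at_critical_point:
  assumes "0 \<le> x" "x \<le> R" "u1 x = 0" "u x > 0"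
  shows "lam + \<bar>u x\<bar> powr (p - 2) > 0"
proof -
  define U where "U = \<bar>u x\<bar> powr (p - 2)"
  have U: "U > 0" using assms by (simp add: U_def)
  have "\<bar>u x\<bar> powr p = U * (u x)\<^sup>2"
    unfolding U_def by (rule abs_powr_eq_mult_square)
  then have "(lam / 2 + U / p) * (u x)\<^sup>2 \<ge> 0"
    using energy_nonneg[OF assms(1,2)] assms(3) by (simp add: energy_def algebra_simps)
  then have "lam / 2 + U / p \<ge> 0" using assms(4) by (simp add: zero_le_mult_iff)
  moreover have "U / p < U / 2" using U p_gt_2 by (intro divide_strict_left_mono) auto
  ultimately show ?thesis unfolding U_def by linarith
qed

text \<open>Divergence form of the equation: \<open>a powr (n - 1)\<close> is the integrating factor
  of the first-order term, so the reaction alone decides the sign.\<close>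

lemma flux_deriv:
  assumes "0 < x" "x < R"
  shows "((\<lambda>x. a x powr (n - 1) * u1 x) has_real_derivative
    - (a x powr (n - 1) * (u x * (lam + \<bar>u x\<bar> powr (p - 2))))) (at x)"
proof -
  have a: "a x > 0" using a_pos assms by simp
  have pw: "a x powr (n - 1) = a x powr (n - 1 - 1) * a x"
    using a powr_add[of "a x" "n - 2" 1] by simp
  have "((\<lambda>x. a x powr (n - 1) * u1 x) has_real_derivative
      (n - 1) * a x powr (n - 1 - 1) * a1 x * u1 x + a x powr (n - 1) * u2 x) (at x)"
    using a by (auto intro!: derivative_eq_intros a_deriv u1_deriv assms simp: algebra_simps)
  moreover have "(n - 1) * a x powr (n - 1 - 1) * a1 x * u1 x + a x powr (n - 1) * u2 x
      = - (a x powr (n - 1) * (u x * (lam + \<bar>u x\<bar> powr (p - 2))))"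
    using a unfolding ode[OF assms] pw by (simp add: field_simps)
  ultimately show ?thesis by simp
qed

text \<open>If \<open>u1 z > 0\<close>, let \<open>y\<close> be the last point before
  \<open>z\<close> with nonpositive flux. There \<open>u1 y = 0\<close>, so the reaction is positive
  at \<open>y\<close> and, by continuity, just to its right; hence the flux cannot increase right
  after \<open>y\<close>, a contradiction.\<close>

lemma u1_nonpos:
  assumes "0 < z" "z < r" "r \<le> R" and pos: "\<And>x. 0 \<le> x \<Longrightarrow> x < r \<Longrightarrow> u x > 0"
  shows "u1 z \<le> 0"
proof (rule ccontr)
  assume "\<not> u1 z \<le> 0"
  define v where "v = (\<lambda>x. a x powr (n - 1) * u1 x)"
  have v_cont: "continuous_on {0..z} v"
    unfolding v_def using n assms(1-3)
    by (intro continuous_on_mult continuous_on_powr' cont_sub continuous_on_const)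
      (auto intro: a_nonneg)
  have "v 0 \<le> 0" by (simp add: v_def u1_0)
  with last_sublevel_point[OF v_cont] obtain y where y: "0 \<le> y" "y \<le> z" "v y \<le> 0"
      "\<And>t. y < t \<Longrightarrow> t \<le> z \<Longrightarrow> v t > 0"
    using assms(1) by (metis less_imp_le)
  have "v z > 0" using \<open>\<not> u1 z \<le> 0\<close> a_pos[of z] assms(1-3) by (simp add: v_def)
  then have "y < z" using y(2,3) by (cases "y = z") auto
  note vpos = y(4)
  have "u1 y \<ge> 0"
  proof -
    have "u1 t \<ge> 0" if "t \<in> {y<..<z}" for t
      using vpos[of t] that a_nonneg[of t] assms y(1)
      by (auto simp: v_def zero_less_mult_iff)
    have "(u1 \<longlongrightarrow> u1 y) (at_right y)"
      using continuous_on_Icc_at_rightD[OF cont_sub(4)[of "{y..z}"]] \<open>y < z\<close> y(1) assms by auto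
    moreover have "eventually (\<lambda>t. 0 \<le> u1 t) (at_right y)"
      by (rule eventually_mono[OF eventually_at_right_real[OF \<open>y < z\<close>]]) fact
    ultimately show ?thesis by (rule tendsto_lowerbound) simp
  qed
  \<comment> \<open>At \<open>y = 0\<close> the flux vanishes with \<open>a\<close> and says nothing
    about \<open>u1\<close>; there the boundary condition is used instead.\<close>
  then have "u1 y = 0"
    using y(3) u1_0 a_pos[of y] y(1) \<open>y < z\<close> assms
    by (cases "y = 0") (auto simp: v_def mult_le_0_iff)
  define F where "F = (\<lambda>x. lam + \<bar>u x\<bar> powr (p - 2))"
  have "F y > 0"
    unfolding F_def
    by (rule reaction_pos_at_critical_point) (use \<open>u1 y = 0\<close> pos[of y] y(1) \<open>y < z\<close> assms(1-3) in auto)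
  moreover have "(F \<longlongrightarrow> F y) (at_right y)"
  proof -
    have "(u \<longlongrightarrow> u y) (at_right y)"
      using continuous_on_Icc_at_rightD[OF cont_sub(3)[of "{y..z}"]] \<open>y < z\<close> y(1) assms by auto
    then show ?thesis unfolding F_def using p_gt_2 by (intro tendsto_intros) auto
  qed
  ultimately have "eventually (\<lambda>t. F t > 0) (at_right y)" by (rule order_tendstoD(1)[rotated])
  then obtain d where d: "d > y" "\<And>t. y < t \<Longrightarrow> t < d \<Longrightarrow> F t > 0"
    using eventually_at_right[of y "y + 1"] by auto
  define t where "t = min ((y + d) / 2) z"
  have t: "y < t" "t \<le> z" "t < d" using d(1) \<open>y < z\<close> by (auto simp: t_def min_def)
  have "v t \<le> v y"
  proof (rule DERIV_nonpos_imp_decreasing_open[of y t v])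
    show "\<exists>D. (v has_real_derivative D) (at s) \<and> D \<le> 0" if "y < s" "s < t" for s
    proof -
      have "u s * F s \<ge> 0"
        using d(2)[of s] pos[of s] that t y(1) assms(2) by (intro mult_nonneg_nonneg) auto
      moreover have "(v has_real_derivative - (a s powr (n - 1) * (u s * F s))) (at s)"
        unfolding v_def F_def by (rule flux_deriv) (use that t y(1) assms in auto)
      ultimately show ?thesis by (metis mult_nonneg_nonneg neg_le_0_iff_le powr_ge_zero)
    qed
    show "continuous_on {y..t} v"
      using y(1) t by (intro continuous_on_subset[OF v_cont]) auto
  qed (use t in auto)
  then show False using vpos[of t] t y(3) by simp
qed

text \<open>Uniqueness for the initial value problem at \<open>r\<close>: with zero data,
  \<open>Y = u\<^sup>2 + u1\<^sup>2\<close> satisfies a linear differential inequality on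
  \<open>{r/2..r}\<close>, away from the singularity at 0, and would vanish at
  \<open>r / 2\<close>.\<close>

lemma u1_nonzero_at_zero:
  assumes r: "0 < r" "r \<le> R" "u r = 0" and pos: "u (r / 2) > 0"
  shows "u1 r \<noteq> 0"
proof
  assume "u1 r = 0"
  define Y where "Y = (\<lambda>x. (u x)\<^sup>2 + (u1 x)\<^sup>2)"
  \<comment> \<open>\<open>c\<close> is the coefficient of \<open>2 * u * u1\<close> in the
    derivative of \<open>Y\<close>; \<open>h\<close> bounds that derivative below by
    \<open>- h * Y\<close>.\<close>
  define c where "c = (\<lambda>x. 1 - lam - \<bar>u x\<bar> powr (p - 2))"
  define h where "h = (\<lambda>x. \<bar>c x\<bar> + 2 * ((n - 1) * (a1 x / a x)))"
  have sub: "{r/2..r} \<subseteq> {0..R}" using r by auto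
  have "continuous_on {r/2..r} h"
  proof -
    have "\<forall>x\<in>{r/2..r}. a x \<noteq> 0"
    proof
      show "a x \<noteq> 0" if "x \<in> {r/2..r}" for x using a_pos[of x] that r(1,2) by simp
    qed
    then show ?thesis
      unfolding h_def c_def using p_gt_2
      by (intro continuous_on_add continuous_on_diff continuous_on_mult continuous_on_divide
          continuous_on_rabs continuous_on_const continuous_on_abs_powr cont_sub sub) auto
  qed
  then have "bdd_above (h ` {r/2..r})"
    using compact_continuous_image compact_Icc compact_imp_bounded bounded_imp_bdd_above by metis
  then obtain K where K: "\<And>x. x \<in> {r/2..r} \<Longrightarrow> h x \<le> K"
    unfolding bdd_above_def by blast
  have "Y (r/2) \<le> 0"
  proof (rule nonpos_of_zero_at_right_end[where Y = Y and K = K and y = r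
        and Y' = "\<lambda>z. 2 * u z * u1 z + 2 * u1 z * u2 z"])
    show "continuous_on {r/2..r} Y" unfolding Y_def by (intro continuous_intros cont_sub sub)
    show "(Y has_real_derivative (2 * u z * u1 z + 2 * u1 z * u2 z)) (at z)"
      if "r / 2 < z" "z < r" for z
      unfolding Y_def using that r
      by (auto intro!: derivative_eq_intros u_deriv u1_deriv simp: power2_eq_square algebra_simps)
    show "2 * u z * u1 z + 2 * u1 z * u2 z \<ge> - K * Y z" if z: "r / 2 < z" "z < r" for z
    proof -
      have "2 * u z * u1 z + 2 * u1 z * u2 z
          = c z * (2 * u z * u1 z) - 2 * ((n - 1) * (a1 z / a z)) * (u1 z)\<^sup>2"
      proof -
        define B where "B = a1 z / a z"
        have u2: "u2 z = - (n - 1) * B * u1 z - u z * (1 - c z)"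
          using z r by (simp add: ode B_def c_def)
        show ?thesis unfolding u2 B_def[symmetric] by (simp add: algebra_simps power2_eq_square)
      qed
      moreover have "\<bar>c z * (2 * u z * u1 z)\<bar> \<le> \<bar>c z\<bar> * Y z"
      proof -
        have "\<bar>2 * u z * u1 z\<bar> \<le> Y z"
          unfolding Y_def using sum_squares_bound[of "\<bar>u z\<bar>" "\<bar>u1 z\<bar>"] by (simp add: abs_mult)
        then show ?thesis by (simp only: abs_mult[of "c z"] mult_left_mono abs_ge_zero)
      qed
      moreover have "2 * ((n - 1) * (a1 z / a z)) * (u1 z)\<^sup>2 \<le> 2 * ((n - 1) * (a1 z / a z)) * Y z"
        using n a_pos[of z] a1_pos[of z] z r by (intro mult_left_mono) (auto simp: Y_def)
      moreover have "h z * Y z \<le> K * Y z"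
        using K[of z] z by (intro mult_right_mono) (auto simp: Y_def)
      ultimately show ?thesis unfolding h_def by (simp add: algebra_simps)
    qed
  qed (use r \<open>u1 r = 0\<close> in \<open>auto simp: Y_def\<close>)
  moreover have "Y (r/2) > 0" unfolding Y_def using pos by (simp add: add_pos_nonneg)
  ultimately show False by simp
qed

lemma first_zero:
  assumes "u 0 > 0"
  obtains r where "0 < r" "r \<le> R" "u r = 0" "\<And>x. 0 \<le> x \<Longrightarrow> x < r \<Longrightarrow> u x > 0"
    "\<And>x. 0 \<le> x \<Longrightarrow> x \<le> r \<Longrightarrow> u1 x \<le> 0" "u1 r < 0"
proof -
  obtain r where r: "0 \<le> r" "r \<le> R" "u r \<le> 0" and pos: "\<And>t. 0 \<le> t \<Longrightarrow> t < r \<Longrightarrow> u t > 0"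
    using first_sublevel_point[OF cont(3), of 0] R by (auto simp: u_R)
  \<comment> \<open>The sublevel point only gives \<open>u r \<le> 0\<close>; a zero at or before
    \<open>r\<close> must be \<open>r\<close> itself.\<close>
  obtain t where "0 \<le> t" "t \<le> r" "u t = 0"
    using IVT2'[of u r 0 0] assms r cont_sub(3)[of "{0..r}"] by auto
  then have "u r = 0" using pos[of t] by (cases "t = r") auto
  then have r': "0 < r" "r \<le> R" "u r = 0" using r assms by (auto simp: less_le)
  have nonpos: "u1 x \<le> 0" if "0 \<le> x" "x < r" for x
    using u1_nonpos[of x r] u1_0 that r' pos by (cases "x = 0") auto
  have "(u1 \<longlongrightarrow> u1 r) (at_left r)"
    using continuous_on_Icc_at_leftD[OF cont_sub(4)[of "{0..r}"]] r' by auto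
  moreover have "eventually (\<lambda>t. u1 t \<le> 0) (at_left r)"
    by (rule eventually_mono[OF eventually_at_left_real[OF r'(1)]]) (use nonpos in simp)
  ultimately have "u1 r \<le> 0"
    by (rule tendsto_upperbound) simp
  moreover have "u1 r \<noteq> 0" using u1_nonzero_at_zero r' pos[of "r/2"] by simp
  ultimately have "u1 r < 0" by simp
  moreover have "u1 x \<le> 0" if "0 \<le> x" "x \<le> r" for x
    using nonpos[of x] that \<open>u1 r < 0\<close> by (cases "x = r") auto
  ultimately show ?thesis using that[OF r' pos] by blast
qed

end

subsection \<open>The weighted Pohozaev function\<close>

text \<open>Hypothesis \<open>dT\<close> says that \<open>T\<close> is a supersolution of the
  Riccati equation obtained by putting \<open>u' = - T u\<close> into the linear equation. With
  these \<open>A\<close> and \<open>\<sigma>\<close>, right side minus left side factors as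
  \<open>(1 - \<sigma> / T\<^sup>2) / 2\<close> times the Riccati defect, and both factors are
  nonnegative.\<close>

lemma barrier_inequality:
  fixes n lam :: real
  assumes "n > 2" "T > 0" "\<sigma> = (n - 2) * lam / n" "\<sigma> \<le> T\<^sup>2"
    and dT: "T\<^sup>2 - (n - 1) * b * T + lam \<le> dT"
    and A: "A = (T + \<sigma> / T) / 2" and dA: "dA = dT / 2 * (1 - \<sigma> / T\<^sup>2)"
  shows "(n - 1) / ((n - 2) / 2) * (A - (n - 2) / 2 * b) * T
    \<le> - (2 * lam / n) + dA - (n - 1) * b * A + 2 * n / (n - 2) * A\<^sup>2"
proof -
  define m where "m = (n - 2) / 2"
  have m: "m > 0" "n = 2 * m + 2" using assms(1) by (auto simp: m_def diff_divide_distrib)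
  have "\<sigma> = m * lam / (m + 1)"
    using m(1) unfolding assms(3) m(2) by (simp add: divide_simps)
  then have lam: "lam = (m + 1) * \<sigma> / m" using m(1) by simp
  have "- (2 * lam / n) + dA - (n - 1) * b * A + 2 * n / (n - 2) * A\<^sup>2
      - (n - 1) / ((n - 2) / 2) * (A - (n - 2) / 2 * b) * T
    = (1 - \<sigma> / T\<^sup>2) / 2 * (dT - (T\<^sup>2 - (n - 1) * b * T + lam))"
  proof -
    have "2 * lam / n = \<sigma> / m" using m unfolding lam m(2) by (simp add: divide_simps)
    then show ?thesis
      unfolding A dA lam m(2) using m(1) \<open>T > 0\<close>
      by (simp add: divide_simps) (simp add: algebra_simps power2_eq_square)
  qed
  moreover have "(1 - \<sigma> / T\<^sup>2) / 2 \<ge> 0" using assms(2,4) by simp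
  ultimately show ?thesis using dT
    by (metis diff_ge_0_iff_ge mult_nonneg_nonneg)
qed

text \<open>The power terms \<open>U * v * v1\<close> cancel, and what has no factor
  \<open>v1\<close> on the left is \<open>- (A - m * b) * (lam + U) * v\<^sup>2\<close>, because
  \<open>n / p = m\<close>. A multiple of \<open>P\<close> absorbs it.\<close>

lemma pohozaev_algebra:
  fixes A A' P U b lam m n p v v1 v2 :: real
  assumes "m > 0" "n = 2 * m + 2" "p = (2 * m + 2) / m"
    and "v2 = - (n - 1) * b * v1 - v * (lam + U)"
    and "P = v1\<^sup>2 / 2 + A * v * v1 + (lam * v\<^sup>2 + U * v\<^sup>2) / p"
  shows "n * b * P + (v1 * v2 + (A' * v * v1 + A * v1 * v1 + A * v * v2)
      + (lam * (2 * v * v1) + p * (U * v) * v1) / p)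
    = - p * (A - m * b) * P + (n - 1) / m * (A - m * b) * v1\<^sup>2
      + v * v1 * (- (2 * lam / n) + A' - (n - 1) * b * A + p * A\<^sup>2)"
  unfolding assms(2-5) using assms(1)
  by (simp add: divide_simps) (simp add: algebra_simps power2_eq_square)

context radial_bvp
begin

text \<open>The quadratic term carries \<open>lam / p\<close>, in place of the
  \<open>lam / 2\<close> of \<open>energy\<close>, so that the last summand is \<open>u / p\<close>
  times the reaction \<open>u * (lam + \<bar>u\<bar> powr (p - 2))\<close>.\<close>

definition pohozaev :: "(real \<Rightarrow> real) \<Rightarrow> real \<Rightarrow> real" where
  "pohozaev A x = (u1 x)\<^sup>2 / 2 + A x * u x * u1 x + (lam * (u x)\<^sup>2 + \<bar>u x\<bar> powr p) / p"

lemma pohozaev_deriv: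
  fixes A :: "real \<Rightarrow> real" and dA x :: real
  assumes x: "0 < x" "x < R" and A: "(A has_real_derivative dA) (at x)"
  defines "b \<equiv> a1 x / a x" and "m \<equiv> (n - 2) / 2"
  shows "((\<lambda>x. a x powr n * pohozaev A x) has_real_derivative
    a x powr n * (- p * (A x - m * b) * pohozaev A x + (n - 1) / m * (A x - m * b) * (u1 x)\<^sup>2
      + u x * u1 x * (- (2 * lam / n) + dA - (n - 1) * b * A x + p * (A x)\<^sup>2))) (at x)"
proof -
  define U where "U = \<bar>u x\<bar> powr (p - 2)"
  have a: "a x > 0" using a_pos x by simp
  have m: "m > 0" "n = 2 * m + 2" and p': "p = (2 * m + 2) / m"
    using n by (auto simp: m_def p divide_simps)
  have U: "\<bar>u x\<bar> powr p = U * (u x)\<^sup>2" unfolding U_def by (rule abs_powr_eq_mult_square)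
  have "((\<lambda>x. \<bar>u x\<bar> powr p) has_real_derivative p * (U * u x) * u1 x) (at x)"
    using DERIV_chain2[OF has_real_derivative_abs_powr u_deriv[OF x]] p_gt_2 by (simp add: U_def)
  then have "(pohozaev A has_real_derivative u1 x * u2 x
      + (dA * u x * u1 x + A x * u1 x * u1 x + A x * u x * u2 x)
      + (lam * (2 * u x * u1 x) + p * (U * u x) * u1 x) / p) (at x)"
    unfolding pohozaev_def[abs_def]
    by (rule DERIV_cong[OF DERIV_add[OF DERIV_add[OF
          DERIV_cdivide[OF DERIV_power[OF u1_deriv[OF x], where n = 2]]
          DERIV_mult[OF DERIV_mult[OF A u_deriv[OF x]] u1_deriv[OF x]]]
          DERIV_cdivide[OF DERIV_add[OF DERIV_cmult[OF DERIV_power[OF u_deriv[OF x], where n = 2]]]]]])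
      (simp add: algebra_simps)
  moreover have "((\<lambda>x. a x powr n) has_real_derivative a x powr n * (n * b)) (at x)"
    using DERIV_fun_powr[OF a_deriv[OF x] a, of n] a powr_diff[of "a x" n 1]
    by (simp add: b_def field_simps)
  ultimately have deriv: "((\<lambda>x. a x powr n * pohozaev A x) has_real_derivative
      a x powr n * (n * b) * pohozaev A x + (u1 x * u2 x
      + (dA * u x * u1 x + A x * u1 x * u1 x + A x * u x * u2 x)
      + (lam * (2 * u x * u1 x) + p * (U * u x) * u1 x) / p) * a x powr n) (at x)"
    by (rule DERIV_mult[rotated])
  have eq: "n * b * pohozaev A x + (u1 x * u2 x
      + (dA * u x * u1 x + A x * u1 x * u1 x + A x * u x * u2 x)
      + (lam * (2 * u x * u1 x) + p * (U * u x) * u1 x) / p)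
    = - p * (A x - m * b) * pohozaev A x + (n - 1) / m * (A x - m * b) * (u1 x)\<^sup>2
      + u x * u1 x * (- (2 * lam / n) + dA - (n - 1) * b * A x + p * (A x)\<^sup>2)"
    by (rule pohozaev_algebra[OF m p'])
      (simp_all add: ode[OF x] U_def[symmetric] b_def[symmetric] pohozaev_def U)
  show ?thesis
    by (rule DERIV_cong[OF deriv], subst eq[symmetric]) (simp add: algebra_simps)
qed

text \<open>\<open>A\<close> may blow up at 0, but it enters only through
  \<open>A * u * u1 \<le> 0\<close>. Dropping this term leaves a continuous majorant, which
  \<open>a powr n\<close> makes vanish at 0.\<close>

lemma pohozaev_weighted_nonpos:
  fixes A dA :: "real \<Rightarrow> real" and c :: real
  assumes c: "0 < c" "c \<le> R" and "continuous_on {0<..c} A"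
    and "\<And>x. 0 < x \<Longrightarrow> x < c \<Longrightarrow> (A has_real_derivative dA x) (at x)"
    and "\<And>x. 0 < x \<Longrightarrow> x \<le> c \<Longrightarrow> A x \<ge> 0 \<and> u x \<ge> 0 \<and> u1 x \<le> 0"
    and "\<And>x. 0 < x \<Longrightarrow> x < c \<Longrightarrow> pohozaev A x > 0 \<Longrightarrow>
      - p * (A x - (n - 2) / 2 * (a1 x / a x)) * pohozaev A x
      + (n - 1) / ((n - 2) / 2) * (A x - (n - 2) / 2 * (a1 x / a x)) * (u1 x)\<^sup>2
      + u x * u1 x * (- (2 * lam / n) + dA x - (n - 1) * (a1 x / a x) * A x + p * (A x)\<^sup>2) \<le> 0"
  shows "pohozaev A c \<le> 0"
proof -
  have sub: "{0<..c} \<subseteq> {0..R}" "{0..c} \<subseteq> {0..R}" using c by auto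
  have "a c powr n * pohozaev A c \<le> 0"
  proof (rule nonpos_from_zero[where f = "\<lambda>x. a x powr n * pohozaev A x" and c = c
        and g = "\<lambda>x. a x powr n * ((u1 x)\<^sup>2 / 2 + (lam * (u x)\<^sup>2 + \<bar>u x\<bar> powr p) / p)"])
    show "continuous_on {0<..c} (\<lambda>x. a x powr n * pohozaev A x)"
      unfolding pohozaev_def using p_gt_2 n c
      by (intro continuous_on_mult continuous_on_powr' continuous_on_add continuous_on_divide
          continuous_on_power continuous_on_abs_powr continuous_on_const cont_sub sub assms(3))
        (auto intro: a_nonneg)
    show "continuous_on {0..c} (\<lambda>x. a x powr n * ((u1 x)\<^sup>2 / 2 + (lam * (u x)\<^sup>2 + \<bar>u x\<bar> powr p) / p))"
      using p_gt_2 n c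
      by (intro continuous_on_mult continuous_on_powr' continuous_on_add continuous_on_divide
          continuous_on_power continuous_on_abs_powr continuous_on_const cont_sub sub)
        (auto intro: a_nonneg)
    show "a x powr n * pohozaev A x \<le> a x powr n * ((u1 x)\<^sup>2 / 2 + (lam * (u x)\<^sup>2 + \<bar>u x\<bar> powr p) / p)"
      if "0 < x" "x \<le> c" for x
    proof -
      have "A x * u x * u1 x \<le> 0" using assms(5)[OF that] by (simp add: mult_nonneg_nonpos)
      then show ?thesis unfolding pohozaev_def by (intro mult_left_mono) auto
    qed
    show "((\<lambda>x. a x powr n * pohozaev A x) has_real_derivative
      a z powr n * (- p * (A z - (n - 2) / 2 * (a1 z / a z)) * pohozaev A z
      + (n - 1) / ((n - 2) / 2) * (A z - (n - 2) / 2 * (a1 z / a z)) * (u1 z)\<^sup>2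
      + u z * u1 z * (- (2 * lam / n) + dA z - (n - 1) * (a1 z / a z) * A z + p * (A z)\<^sup>2))) (at z)"
      if "0 < z" "z < c" for z
      using that c assms(4)[OF that] by (intro pohozaev_deriv) auto
    show "a z powr n * (- p * (A z - (n - 2) / 2 * (a1 z / a z)) * pohozaev A z
      + (n - 1) / ((n - 2) / 2) * (A z - (n - 2) / 2 * (a1 z / a z)) * (u1 z)\<^sup>2
      + u z * u1 z * (- (2 * lam / n) + dA z - (n - 1) * (a1 z / a z) * A z + p * (A z)\<^sup>2)) \<le> 0"
      if "0 < z" "z < c" "a z powr n * pohozaev A z > 0" for z
    proof (rule mult_nonneg_nonpos[OF powr_ge_zero assms(6)[OF that(1,2)]])
      show "pohozaev A z > 0" using that(3) by (simp add: zero_less_mult_iff)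
    qed
  qed (use c a_0 in auto)
  then show ?thesis using a_pos[OF c] by (simp add: mult_le_0_iff)
qed

section \<open>The logarithmic derivative of \<open>a\<close>\<close>

lemma log_deriv_deriv:
  assumes "0 < x" "x < R"
  shows "((\<lambda>x. a1 x / a x) has_real_derivative a2 x / a x - (a1 x / a x)\<^sup>2) (at x)"
  by (rule DERIV_cong[OF DERIV_divide[OF a1_deriv a_deriv]])
    (use assms a_pos[of x] in \<open>auto simp: field_simps power2_eq_square\<close>)

lemma log_deriv_cont: "c \<le> R \<Longrightarrow> continuous_on {0<..c} (\<lambda>x. a1 x / a x)"
  using a_pos by (intro continuous_on_divide cont_sub) force+

lemma log_deriv_nonneg:
  assumes "0 < x" "x \<le> R"
  shows "a1 x / a x \<ge> 0"
proof -
  have "a1 x \<ge> 0"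
  proof (cases "x = R")
    case True
    have "(a1 \<longlongrightarrow> a1 R) (at_left R)" using continuous_on_Icc_at_leftD[OF cont(2) R] .
    moreover have "eventually (\<lambda>t. 0 \<le> a1 t) (at_left R)"
      by (rule eventually_mono[OF eventually_at_left_real[OF R]]) (use a1_pos in \<open>simp add: less_imp_le\<close>)
    ultimately show ?thesis unfolding True by (rule tendsto_lowerbound) simp
  qed (use assms a1_pos[of x] in simp)
  then show ?thesis using a_pos[OF assms] by simp
qed

text \<open>\<open>a1\<^sup>2 - w * a\<^sup>2\<close> has derivative
  \<open>2 * a1 * (a2 - w * a) \<ge> 0\<close> and starts at
  \<open>(a1 0)\<^sup>2 \<ge> 0\<close>.\<close>

lemma log_deriv_ge_sqrt:
  assumes x: "0 < x" "x \<le> R" and "w \<ge> 0"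
    and a2: "\<And>x. 0 < x \<Longrightarrow> x < R \<Longrightarrow> w * a x \<le> a2 x"
  shows "sqrt w \<le> a1 x / a x"
proof -
  have "(a1 0)\<^sup>2 - w * (a 0)\<^sup>2 \<le> (a1 x)\<^sup>2 - w * (a x)\<^sup>2"
  proof (rule DERIV_nonneg_imp_increasing_open[of 0 x "\<lambda>x. (a1 x)\<^sup>2 - w * (a x)\<^sup>2"])
    show "\<exists>d. ((\<lambda>x. (a1 x)\<^sup>2 - w * (a x)\<^sup>2) has_real_derivative d) (at z) \<and> 0 \<le> d"
      if "0 < z" "z < x" for z
    proof (intro exI conjI)
      show "((\<lambda>x. (a1 x)\<^sup>2 - w * (a x)\<^sup>2) has_real_derivative 2 * a1 z * (a2 z - w * a z)) (at z)"
        by (rule DERIV_cong[OF DERIV_diff[OF DERIV_power[OF a1_deriv, where n = 2]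
            DERIV_cmult[OF DERIV_power[OF a_deriv, where n = 2]]]])
          (use that x in \<open>auto simp: algebra_simps\<close>)
      show "0 \<le> 2 * a1 z * (a2 z - w * a z)" using a1_pos[of z] a2[of z] that x by simp
    qed
    show "continuous_on {0..x} (\<lambda>x. (a1 x)\<^sup>2 - w * (a x)\<^sup>2)"
      using x by (intro continuous_intros cont_sub) auto
  qed (use x in simp)
  with zero_le_power2[of "a1 0"] have "w * (a x)\<^sup>2 \<le> (a1 x)\<^sup>2"
    unfolding a_0 zero_power2 mult_zero_right by linarith
  then have "w \<le> (a1 x / a x)\<^sup>2" using a_pos[OF x] by (simp add: power_divide pos_le_divide_eq)
  then show ?thesis using real_le_lsqrt log_deriv_nonneg[OF x] by blast
qed

subsection \<open>Nonexistence of solutions positive at the origin\<close>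

text \<open>The weight \<open>A = m * b\<close> removes every term with the factor
  \<open>A - m * b\<close>; only \<open>u * u1\<close> times a bracket remains, and the bound on
  \<open>lam\<close> makes that bracket nonnegative.\<close>

lemma no_positive_start_small_lam:
  assumes "u 0 > 0" and w: "w \<ge> 0" "\<And>x. 0 < x \<Longrightarrow> x < R \<Longrightarrow> w * a x \<le> a2 x"
    and lam: "lam \<le> n * (n - 2) / 4 * w"
  shows False
proof -
  obtain r where r: "0 < r" "r \<le> R" "u r = 0" "\<And>x. 0 \<le> x \<Longrightarrow> x < r \<Longrightarrow> u x > 0"
    "\<And>x. 0 \<le> x \<Longrightarrow> x \<le> r \<Longrightarrow> u1 x \<le> 0" "u1 r < 0"
    using first_zero[OF assms(1)] by metis
  define m where "m = (n - 2) / 2"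
  define b where "b = (\<lambda>x. a1 x / a x)"
  define A where "A = (\<lambda>x. m * b x)"
  define dA where "dA = (\<lambda>x. m * (a2 x / a x - (b x)\<^sup>2))"
  have m: "m > 0" "n = 2 * m + 2" using n by (simp_all add: m_def diff_divide_distrib)
  have "pohozaev A r \<le> 0"
  proof (rule pohozaev_weighted_nonpos[where dA = dA])
    show "continuous_on {0<..r} A"
      unfolding A_def b_def using log_deriv_cont[OF r(2)] by (intro continuous_on_mult continuous_on_const)
    show "(A has_real_derivative dA x) (at x)" if "0 < x" "x < r" for x
      unfolding A_def dA_def b_def using that r(2) by (intro DERIV_cmult log_deriv_deriv) auto
    show "A x \<ge> 0 \<and> u x \<ge> 0 \<and> u1 x \<le> 0" if "0 < x" "x \<le> r" for x
    proof -
      have "A x \<ge> 0"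
        unfolding A_def b_def using log_deriv_nonneg[of x] that r(2) m(1)
        by (intro mult_nonneg_nonneg) auto
      then show ?thesis using r(4)[of x] r(3) r(5)[of x] that by (cases "x = r") auto
    qed
    fix x assume x: "0 < x" "x < r"
    have "2 * lam / n \<le> m * w"
      using lam n by (simp add: m_def field_simps)
    also have "\<dots> \<le> m * (a2 x / a x)"
      using w(2)[of x] a_pos[of x] x r(2) m(1) by (simp add: pos_le_divide_eq)
    finally have "0 \<le> - (2 * lam / n) + m * (a2 x / a x)" by simp
    \<comment> \<open>The contributions of \<open>(b x)\<^sup>2\<close> cancel because
      \<open>p * m = n\<close>.\<close>
    also have "\<dots> = - (2 * lam / n) + dA x - (n - 1) * b x * A x + p * (A x)\<^sup>2"
    proof -
      have "p * m = n" using m by (simp add: p field_simps)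
      then have "p * (A x)\<^sup>2 = n * m * (b x)\<^sup>2"
        unfolding A_def by (metis mult.assoc power2_eq_square power_mult_distrib)
      then show ?thesis
        unfolding \<open>p * (A x)\<^sup>2 = _\<close> by (simp add: A_def dA_def algebra_simps power2_eq_square)
    qed
    finally have "u x * u1 x * (- (2 * lam / n) + dA x - (n - 1) * b x * A x + p * (A x)\<^sup>2) \<le> 0"
      using r(4)[of x] r(5)[of x] x by (intro mult_nonpos_nonneg mult_nonneg_nonpos) auto
    moreover have "A x - (n - 2) / 2 * (a1 x / a x) = 0" by (simp add: A_def m_def b_def)
    ultimately show "- p * (A x - (n - 2) / 2 * (a1 x / a x)) * pohozaev A x
      + (n - 1) / ((n - 2) / 2) * (A x - (n - 2) / 2 * (a1 x / a x)) * (u1 x)\<^sup>2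
      + u x * u1 x * (- (2 * lam / n) + dA x - (n - 1) * (a1 x / a x) * A x + p * (A x)\<^sup>2) \<le> 0"
      unfolding b_def by (simp only: mult_zero_right mult_zero_left add_0_left)
  qed (use r in auto)
  moreover have "pohozaev A r > 0" using r(3,6) by (simp add: pohozaev_def)
  ultimately show False by simp
qed

text \<open>The condition on \<open>K\<close> is what the Riccati inequality for
  \<open>T = (n - 2) * b + K\<close> becomes once \<open>a2 / a\<close> is replaced by its lower
  bound \<open>w\<close>. It is asked for all \<open>b \<ge> sqrt w\<close> since the logarithmic
  derivative of \<open>a\<close> lies in that range.\<close>

lemma no_positive_start_pos_lam:
  assumes "u 0 > 0" "lam > 0" and w: "w > 0" "\<And>x. 0 < x \<Longrightarrow> x < R \<Longrightarrow> w * a x \<le> a2 x"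
    and K: "K \<ge> 0" "\<And>b. b \<ge> sqrt w \<Longrightarrow> (n - 3) * K * b \<le> (n - 2) * w - lam - K\<^sup>2"
  shows False
proof -
  obtain r where r: "0 < r" "r \<le> R" "u r = 0" "\<And>x. 0 \<le> x \<Longrightarrow> x < r \<Longrightarrow> u x > 0"
    "\<And>x. 0 \<le> x \<Longrightarrow> x \<le> r \<Longrightarrow> u1 x \<le> 0" "u1 r < 0"
    using first_zero[OF assms(1)] by metis
  define s where "s = sqrt w"
  define b where "b = (\<lambda>x. a1 x / a x)"
  define T where "T = (\<lambda>x. (n - 2) * b x + K)"
  define \<sigma> where "\<sigma> = (n - 2) * lam / n"
  define A where "A = (\<lambda>x. (T x + \<sigma> / T x) / 2)"
  define dT where "dT = (\<lambda>x. (n - 2) * (a2 x / a x - (b x)\<^sup>2))"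
  define dA where "dA = (\<lambda>x. dT x / 2 * (1 - \<sigma> / (T x)\<^sup>2))"
  define h where "h = (\<lambda>x. u1 x + T x * u x)"
  have s: "s > 0" "s\<^sup>2 = w" using w(1) by (auto simp: s_def)
  have \<sigma>: "\<sigma> > 0" "\<sigma> / 2 = lam / p" using n \<open>lam > 0\<close> by (auto simp: \<sigma>_def p field_simps)
  have b: "s \<le> b x" if "0 < x" "x \<le> R" for x
    unfolding s_def b_def using log_deriv_ge_sqrt[OF that less_imp_le[OF w(1)] w(2)] .
  have T: "(n - 2) * s + K \<le> T x" if "0 < x" "x \<le> R" for x
    unfolding T_def using b[OF that] n by simp
  have T_pos: "T x > 0" if "0 < x" "x \<le> R" for x
  proof -
    have "(n - 2) * s > 0" using n s by simp
    then show ?thesis using T[OF that] K(1) by linarith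
  qed
  have \<sigma>_le: "\<sigma> \<le> (T x)\<^sup>2" if "0 < x" "x \<le> R" for x
  proof -
    have "lam \<le> (n - 2) * s\<^sup>2 - K\<^sup>2 - (n - 3) * K * s"
      using K(2)[of s] s by (simp add: s_def)
    also have "\<dots> \<le> (n - 2) * s\<^sup>2 + K * s"
    proof -
      have "(n - 3) * (K * s) \<ge> (-1) * (K * s)" using n K(1) s by (intro mult_right_mono) auto
      then show ?thesis unfolding mult.assoc using zero_le_power2[of K] by linarith
    qed
    finally have "\<sigma> \<le> (n - 2) / n * ((n - 2) * s\<^sup>2 + K * s)"
      unfolding \<sigma>_def using n by (simp add: divide_right_mono mult_left_mono)
    also have "\<dots> \<le> (n - 2) * ((n - 2) * s\<^sup>2 + K * s)"
      using n K(1) s by (intro mult_right_mono) (auto simp: divide_le_eq)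
    also have "\<dots> \<le> ((n - 2) * s + K)\<^sup>2"
    proof -
      have "((n - 2) * s + K)\<^sup>2 = (n - 2) * ((n - 2) * s\<^sup>2 + K * s) + ((n - 2) * (K * s) + K\<^sup>2)"
        by (simp add: power2_eq_square algebra_simps)
      moreover have "(n - 2) * (K * s) + K\<^sup>2 \<ge> 0" using n K(1) s(1) by simp
      ultimately show ?thesis by linarith
    qed
    also have "\<dots> \<le> (T x)\<^sup>2"
      using T[OF that] n K(1) s by (intro power_mono) auto
    finally show ?thesis .
  qed
  have T_cont: "continuous_on {0<..r} T"
    unfolding T_def b_def using log_deriv_cont[OF r(2)]
    by (intro continuous_on_add continuous_on_mult continuous_on_const)
  have T_deriv: "(T has_real_derivative dT x) (at x)" if "0 < x" "x < R" for x
    unfolding T_def dT_def b_def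
    by (rule DERIV_cong[OF DERIV_add[OF DERIV_cmult[OF log_deriv_deriv[OF that]] DERIV_const]]) simp
  have A_excess: "A x - (n - 2) / 2 * b x = (K + \<sigma> / T x) / 2" for x
    by (simp add: A_def T_def field_simps)

  obtain e where e: "0 < e" "e < r" "\<And>x. 0 < x \<Longrightarrow> x \<le> e \<Longrightarrow> h x > 0"
  proof -
    \<comment> \<open>\<open>T\<close> is only controlled from below near 0; replacing it by the
      constant \<open>(n - 2) * s\<close> gives a minorant of \<open>h\<close> that is continuous at
      0 and positive there.\<close>
    define k where "k = (\<lambda>x. u1 x + (n - 2) * s * u x)"
    have "continuous_on {0..R} k" unfolding k_def by (intro continuous_intros cont)
    then have "(k \<longlongrightarrow> k 0) (at_right 0)" using continuous_on_Icc_at_rightD R by blast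
    moreover have "k 0 > 0" using assms(1) n s by (simp add: k_def u1_0)
    ultimately have "eventually (\<lambda>x. k x > 0) (at_right 0)" by (rule order_tendstoD(1))
    then obtain d where d: "d > 0" "\<And>x. 0 < x \<Longrightarrow> x < d \<Longrightarrow> k x > 0"
      using eventually_at_right[of 0 "1 :: real"] by auto
    have "h x > 0" if "0 < x" "x \<le> min (d / 2) (r / 2)" for x
    proof -
      have "(n - 2) * s * u x \<le> T x * u x"
        using T[of x] K(1) r(4)[of x] r(1,2) that by (intro mult_right_mono) auto
      then show ?thesis using d(2)[of x] d(1) that by (simp add: h_def k_def)
    qed
    then show ?thesis using that[of "min (d / 2) (r / 2)"] d(1) r(1) by (simp add: min_less_iff_disj)
  qed
  have "continuous_on {e..r} h"
    unfolding h_def using e(1) r(2)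
    by (intro continuous_on_add continuous_on_mult cont_sub continuous_on_subset[OF T_cont]) auto
  moreover have "h r \<le> 0" using r(3,6) by (simp add: h_def)
  ultimately obtain c where c: "e \<le> c" "c \<le> r" "h c \<le> 0" "\<And>t. e \<le> t \<Longrightarrow> t < c \<Longrightarrow> h t > 0"
    using first_sublevel_point[of e r h 0, OF _ less_imp_le[OF e(2)]] by blast
  have c0: "0 < c" "c \<le> R" using c e r by auto
  have h_pos: "h x > 0" if "0 < x" "x < c" for x
    using e(3)[of x] c(4)[of x] that by (cases "x \<le> e") auto
  have "pohozaev A c \<le> 0"
  proof (rule pohozaev_weighted_nonpos[where dA = dA])
    show "continuous_on {0<..c} A"
    proof -
      have "T x \<noteq> 0" if "x \<in> {0<..c}" for x using T_pos[of x] that c0 by simp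
      then show ?thesis
        unfolding A_def using c(2)
        by (intro continuous_on_add continuous_on_divide continuous_on_const
            continuous_on_subset[OF T_cont]) auto
    qed
    show "(A has_real_derivative dA x) (at x)" if "0 < x" "x < c" for x
    proof -
      have x: "0 < x" "x < R" "T x > 0" using that c0 T_pos[of x] by auto
      show ?thesis unfolding A_def dA_def
        by (rule DERIV_cong[OF DERIV_cdivide[OF DERIV_add[OF T_deriv[OF x(1,2)]
              DERIV_divide[OF DERIV_const T_deriv[OF x(1,2)]]]]])
          (use x(3) in \<open>auto simp: field_simps power2_eq_square\<close>)
    qed
    show "A x \<ge> 0 \<and> u x \<ge> 0 \<and> u1 x \<le> 0" if "0 < x" "x \<le> c" for x
      using r(4)[of x] r(3) r(5)[of x] T_pos[of x] \<sigma>(1) that c0 c(2)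
      by (cases "x = r") (auto simp: A_def less_imp_le)
    fix x assume x: "0 < x" "x < c" and P: "pohozaev A x > 0"
    define \<delta> where "\<delta> = A x - (n - 2) / 2 * b x"
    define Q where "Q = - (2 * lam / n) + dA x - (n - 1) * b x * A x + p * (A x)\<^sup>2"
    have x': "0 < x" "x \<le> R" "x < R" using x c0 by auto
    have \<delta>: "\<delta> \<ge> 0" unfolding \<delta>_def A_excess using K(1) \<sigma>(1) T_pos[OF x'(1,2)] by simp
    have "(n - 1) / ((n - 2) / 2) * \<delta> * T x \<le> Q"
      unfolding \<delta>_def Q_def p
    proof (rule barrier_inequality[OF n T_pos[OF x'(1,2)] \<sigma>_def \<sigma>_le[OF x'(1,2)]])
      have "(n - 2) * (w - (b x)\<^sup>2) \<le> dT x"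
        unfolding dT_def using n w(2)[of x] x' a_pos[of x]
        by (intro mult_left_mono) (auto simp: pos_le_divide_eq)
      moreover have "(T x)\<^sup>2 - (n - 1) * b x * T x + lam
          = (n - 2) * (w - (b x)\<^sup>2) + ((n - 3) * K * b x - ((n - 2) * w - lam - K\<^sup>2))"
        by (simp add: T_def power2_eq_square algebra_simps)
      ultimately show "(T x)\<^sup>2 - (n - 1) * b x * T x + lam \<le> dT x"
        using K(2)[of "b x"] b[OF x'(1,2)] by (simp add: s_def)
    qed (simp_all add: A_def dA_def)
    moreover have uu1: "u x * u1 x \<le> 0"
      using r(4)[of x] r(5)[of x] x c(2) by (intro mult_nonneg_nonpos) auto
    ultimately have "u x * u1 x * Q \<le> u x * u1 x * ((n - 1) / ((n - 2) / 2) * \<delta> * T x)"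
      by (intro mult_left_mono_neg)
    \<comment> \<open>Here \<open>c\<close> is an arbitrary scalar, not the crossing point. The
      product \<open>u1 x * h x\<close> is nonpositive before the crossing.\<close>
    moreover have "c * (u1 x)\<^sup>2 + u x * u1 x * (c * T x) = c * (u1 x * h x)" for c
      by (simp add: h_def algebra_simps power2_eq_square)
    ultimately have "(n - 1) / ((n - 2) / 2) * \<delta> * (u1 x)\<^sup>2 + u x * u1 x * Q
        \<le> (n - 1) / ((n - 2) / 2) * \<delta> * (u1 x * h x)"
      by (metis add_left_mono)
    also have "\<dots> \<le> 0"
      using n \<delta> h_pos[OF x] r(5)[of x] x c(2)
      by (intro mult_nonneg_nonpos mult_nonpos_nonneg mult_nonneg_nonneg) auto
    finally have "(n - 1) / ((n - 2) / 2) * \<delta> * (u1 x)\<^sup>2 + u x * u1 x * Q \<le> 0" .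
    moreover have "p * \<delta> * pohozaev A x \<ge> 0" using \<delta> P p_gt_2 by simp
    ultimately show "- p * (A x - (n - 2) / 2 * (a1 x / a x)) * pohozaev A x
      + (n - 1) / ((n - 2) / 2) * (A x - (n - 2) / 2 * (a1 x / a x)) * (u1 x)\<^sup>2
      + u x * u1 x * (- (2 * lam / n) + dA x - (n - 1) * (a1 x / a x) * A x + p * (A x)\<^sup>2) \<le> 0"
      unfolding \<delta>_def Q_def b_def by linarith
  qed (use c0 in auto)

  moreover have "pohozaev A c > 0"
  proof (cases "c = r")
    case True
    then show ?thesis using r(3,6) by (simp add: pohozaev_def)
  next
    case False
    then have uc: "u c > 0" using r(4)[of c] c(2) c0 by simp
    \<comment> \<open>Since \<open>\<sigma> / T c \<le> T c\<close>, the second factor of the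
      quadratic part of \<open>pohozaev A c\<close> is at most \<open>h c \<le> 0\<close>, so the
      product of the two is nonnegative.\<close>
    have "\<sigma> / T c * u c \<le> T c * u c"
      using \<sigma>_le[OF c0] T_pos[OF c0] uc by (simp add: pos_divide_le_eq power2_eq_square)
    then have "h c * (u1 c + \<sigma> / T c * u c) / 2 \<ge> 0"
      using c(3) unfolding h_def by (intro divide_nonneg_pos mult_nonpos_nonpos) auto
    moreover have "pohozaev A c = h c * (u1 c + \<sigma> / T c * u c) / 2 + \<bar>u c\<bar> powr p / p"
    proof -
      have "lam * (u c)\<^sup>2 / p = \<sigma> / 2 * (u c)\<^sup>2" by (simp add: \<sigma>(2))
      moreover have "(u1 c)\<^sup>2 / 2 + A c * u c * u1 c + \<sigma> / 2 * (u c)\<^sup>2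
          = h c * (u1 c + \<sigma> / T c * u c) / 2"
        unfolding h_def A_def using T_pos[OF c0] by (simp add: field_simps power2_eq_square)
      ultimately show ?thesis unfolding pohozaev_def add_divide_distrib by linarith
    qed
    moreover have "\<bar>u c\<bar> powr p / p > 0" using uc p_gt_2 by simp
    ultimately show ?thesis by (metis add_nonneg_pos)
  qed
  ultimately show False by simp
qed

lemma no_positive_start:
  assumes "u 0 > 0" and w: "w \<ge> 0" "\<And>x. 0 < x \<Longrightarrow> x < R \<Longrightarrow> w * a x \<le> a2 x"
    and lam: "lam \<le> n\<^sup>2 * (n - 1) / (4 * (n + 2)) * w"
  shows False
proof -
  consider "lam \<le> 0" | "n \<ge> 4" | "lam > 0" "n < 4" by linarith
  then show False
  proof cases
    case 1
    show False
    proof (rule no_positive_start_small_lam[OF assms(1), of 0])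
      show "0 * a x \<le> a2 x" if "0 < x" "x < R" for x
        using w(2)[OF that] w(1) a_pos[of x] that
        by (metis less_imp_le mult_nonneg_nonneg mult_zero_left order_trans)
    qed (use 1 in auto)
  next
    case 2
    \<comment> \<open>After clearing denominators this is
      \<open>n * (n - 1) \<le> n\<^sup>2 - 4\<close>, that is, \<open>n \<ge> 4\<close>.\<close>
    have "n\<^sup>2 * (n - 1) / (4 * (n + 2)) \<le> n * (n - 2) / 4"
      using 2 by (simp add: divide_simps) (simp add: algebra_simps power2_eq_square)
    then have "lam \<le> n * (n - 2) / 4 * w"
      using lam w(1) mult_right_mono order_trans by blast
    then show False using no_positive_start_small_lam[OF assms(1) w] by blast
  next
    case 3
    have "w > 0" using 3 lam w(1) by (cases "w = 0") auto
    define s where "s = sqrt w"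
    have s: "s > 0" "w = s\<^sup>2" using \<open>w > 0\<close> by (auto simp: s_def)
    \<comment> \<open>For \<open>n \<le> 3\<close> this \<open>K\<close> maximises \<open>(n-2)w + (3-n)Ks - K\<^sup>2\<close>; the maximum \<open>(n-1)\<^sup>2w/4\<close> is the spectral bound on hyperbolic space.\<close>
    define K where "K = (if n \<le> 3 then (3 - n) / 2 * s else 0)"
    show False
    proof (rule no_positive_start_pos_lam[OF assms(1) \<open>lam > 0\<close> \<open>w > 0\<close> w(2)])
      show "K \<ge> 0" using s by (simp add: K_def)
      fix b assume b: "b \<ge> sqrt w"
      show "(n - 3) * K * b \<le> (n - 2) * w - lam - K\<^sup>2"
      proof (cases "n \<le> 3")
        case True
        have "n\<^sup>2 * (n - 1) / (4 * (n + 2)) \<le> (n - 1)\<^sup>2 / 4"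
        proof -
          have "n\<^sup>2 * (n - 1) \<le> (n - 1) * (n + 2) * (n - 1)"
            using n by (intro mult_right_mono) (auto simp: power2_eq_square algebra_simps)
          also have "\<dots> = (n - 1)\<^sup>2 / 4 * (4 * (n + 2))"
            by (simp add: power2_eq_square algebra_simps)
          finally show ?thesis using n by (subst pos_divide_le_eq) simp_all
        qed
        then have "lam \<le> (n - 1)\<^sup>2 / 4 * w"
          using lam w(1) mult_right_mono order_trans by blast
        \<comment> \<open>For \<open>n \<le> 3\<close> the coefficient of \<open>b\<close> is
          nonpositive, so the smallest admissible \<open>b\<close> is the worst case.\<close>
        moreover have "(n - 3) * K * b \<le> (n - 3) * K * s"
          using b True \<open>K \<ge> 0\<close> unfolding s_def by (intro mult_left_mono_neg mult_nonpos_nonneg) auto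
        moreover have "(n - 3) * K * s = (n - 2) * w - (n - 1)\<^sup>2 / 4 * w - K\<^sup>2"
          using True by (simp add: K_def s(2) power2_eq_square field_simps)
        ultimately show ?thesis by linarith
      next
        case False
        have "n\<^sup>2 * (n - 1) / (4 * (n + 2)) \<le> n - 2"
        proof -
          \<comment> \<open>This product is
            \<open>4 * (n\<^sup>2 - 4) - n\<^sup>2 * (n - 1)\<close>, the claim with denominators
            cleared.\<close>
          have "(4 - n) * (n * (n - 1) - 4) \<ge> 0"
            using False 3(2) mult_mono[of 3 n 2 "n - 1"] by (intro mult_nonneg_nonneg) auto
          then show ?thesis using n by (simp add: divide_simps) (simp add: algebra_simps power2_eq_square)
        qed
        then have "lam \<le> (n - 2) * w" using lam w(1) mult_right_mono order_trans by blast
        then show ?thesis using False by (simp add: K_def)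
      qed
    qed
  qed
qed

text \<open>The equation is odd in \<open>u\<close>, so a negative value at the origin reduces to a
  positive one.\<close>

lemma uminus_solution:
  "radial_bvp n R lam p a a1 a2 (\<lambda>x. - u x) (\<lambda>x. - u1 x) (\<lambda>x. - u2 x)"
proof
  show "- u2 x = - (n - 1) * (a1 x / a x) * - u1 x - - u x * (lam + \<bar>- u x\<bar> powr (p - 2))"
    if "0 < x" "x < R" for x
    unfolding ode[OF that] by (simp only: abs_minus_cancel mult_minus_right mult_minus_left)
qed (use n R p a_0 a1_pos u1_0 u_R in
  \<open>auto intro!: continuous_intros cont a_deriv a1_deriv DERIV_minus u_deriv u1_deriv\<close>)

lemma solution_trivial:
  assumes "w \<ge> 0" "\<And>x. 0 < x \<Longrightarrow> x < R \<Longrightarrow> w * a x \<le> a2 x"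
    and "lam \<le> n\<^sup>2 * (n - 1) / (4 * (n + 2)) * w" and "x \<in> {0..R}"
  shows "u x = 0"
proof -
  have "\<not> u 0 > 0" using no_positive_start assms(1-3) by blast
  moreover have "\<not> - u 0 > 0"
    using radial_bvp.no_positive_start[OF uminus_solution] assms(1-3) by blast
  ultimately show ?thesis using trivial_if_zero_at_origin assms(4) by simp
qed

end

section \<open>From the \<open>C_k_on\<close> hypotheses and \<open>D_inf\<close> to the reduced
  assumptions\<close>

lemma C_k_on_has_real_derivative:
  assumes "C_k_on k {0..R} f" "j < k" "0 < x" "x < R"
  shows "(nth_deriv_on {0..R} j f has_real_derivative nth_deriv_on {0..R} (Suc j) f x) (at x)"
proof -
  have "nth_deriv_on {0..R} j f differentiable (at x within {0..R})"
    using assms by (auto simp: C_k_on_def differentiable_on_def)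
  then have "(nth_deriv_on {0..R} j f has_vector_derivative nth_deriv_on {0..R} (Suc j) f x)
      (at x within {0..R})"
    by (simp add: vector_derivative_works nth_deriv_on_def)
  then show ?thesis
    using assms(3,4) by (simp add: has_real_derivative_iff_has_vector_derivative at_within_Icc_at)
qed

lemma C_k_on_continuous: "C_k_on k S f \<Longrightarrow> j \<le> k \<Longrightarrow> continuous_on S (nth_deriv_on S j f)"
  by (simp add: C_k_on_def)

lemma nth_deriv_on_0: "nth_deriv_on S 0 f = f"
  by (simp add: nth_deriv_on_def)

text \<open>Multiplying the bound \<open>d\<close> by \<open>a powr (2 * n - 3) * a1\<close> turns
  both sides into exact derivatives. Their difference integrates to \<open>G\<close>, which vanishes
  at 0 because the exponents are positive.\<close>

lemma second_deriv_ge_of_D_bound: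
  fixes a a1 a2 a3 :: "real \<Rightarrow> real"
  assumes "n > 2" and cont: "continuous_on {0..R} a" "continuous_on {0..R} a2"
    and der: "\<And>x. 0 < x \<Longrightarrow> x < R \<Longrightarrow> (a has_real_derivative a1 x) (at x)"
      "\<And>x. 0 < x \<Longrightarrow> x < R \<Longrightarrow> (a2 has_real_derivative a3 x) (at x)"
    and "a 0 = 0" and pos: "\<And>x. 0 < x \<Longrightarrow> x < R \<Longrightarrow> a x > 0 \<and> a1 x > 0"
    and d: "\<And>x. 0 < x \<Longrightarrow> x < R \<Longrightarrow> d \<le> (2 * n - 3) * (a2 x / a x) + a3 x / a1 x"
    and x: "0 < x" "x < R"
  shows "d / (2 * n - 2) * a x \<le> a2 x"
proof -
  define G where "G = (\<lambda>x. a x powr (2 * n - 3) * a2 x - d / (2 * n - 2) * a x powr (2 * n - 2))"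
  have "G 0 \<le> G x"
  proof (rule DERIV_nonneg_imp_increasing_open[of 0 x G])
    show "\<exists>D. (G has_real_derivative D) (at z) \<and> 0 \<le> D" if "0 < z" "z < x" for z
    proof (intro exI conjI)
      have z: "0 < z" "z < R" and a: "a z > 0" "a1 z > 0" using that x pos by auto
      define V where "V = a z powr (2 * n - 3)"
      have V: "a z powr (2 * n - 3 - 1) = V / a z" "a z powr (2 * n - 2 - 1) = V"
        using powr_diff[of "a z" "2 * n - 3" 1] a by (simp_all only: V_def powr_one less_imp_le) simp
      show "(G has_real_derivative
          V * a1 z * ((2 * n - 3) * (a2 z / a z) + a3 z / a1 z - d)) (at z)"
        unfolding G_def
        by (rule DERIV_cong[OF DERIV_diff[OF DERIV_mult[OF DERIV_fun_powr[OF der(1)[OF z] a(1)] der(2)[OF z]]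
              DERIV_cmult[OF DERIV_fun_powr[OF der(1)[OF z] a(1)]]]])
          (simp only: of_nat_1 V V_def[symmetric], use a \<open>n > 2\<close> in \<open>simp add: field_simps\<close>)
      show "0 \<le> V * a1 z * ((2 * n - 3) * (a2 z / a z) + a3 z / a1 z - d)"
        using d[OF z] a by (simp add: V_def)
    qed
    show "continuous_on {0..x} G"
    proof -
      have "a z \<ge> 0" if "z \<in> {0..x}" for z
        using pos[of z] \<open>a 0 = 0\<close> that x by (cases "z = 0") auto
      then show ?thesis
        unfolding G_def using x \<open>n > 2\<close>
        by (intro continuous_on_diff continuous_on_mult continuous_on_powr' continuous_on_const
            continuous_on_subset[OF cont(1)] continuous_on_subset[OF cont(2)]) auto
    qed
  qed (use x in simp)
  then have "0 \<le> G x" using \<open>a 0 = 0\<close> \<open>n > 2\<close> by (simp add: G_def)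
  also have "G x = a x powr (2 * n - 3) * (a2 x - d / (2 * n - 2) * a x)"
    using powr_add[of "a x" "2 * n - 3" 1] pos[OF x] by (simp add: G_def algebra_simps)
  finally show ?thesis using pos[OF x] by (simp add: zero_le_mult_iff)
qed

text \<open>If \<open>D_inf\<close> were \<open>-\<infinity>\<close>, the upper bound for
  \<open>lam\<close> would be \<open>-\<infinity>\<close> as well, which no real number
  satisfies.\<close>

lemma lam_le_of_le_lambda_star:
  assumes "n > 2" "ereal lam \<le> lambda_star n R \<omega> a" "D_inf n R a \<noteq> \<infinity>"
  obtains d where "D_inf n R a = ereal d" "lam \<le> n * (n - 1) / 4 * ((d + 2 * \<omega>) / (2 * (n + 2)))"
proof -
  have "lambda_star n R \<omega> a \<le> ereal (n * (n - 1) / 4) * ((D_inf n R a + ereal (2 * \<omega>)) / ereal (2 * (n + 2)))"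
    unfolding lambda_star_def C_min_def using assms(1) by (intro ereal_mult_left_mono) auto
  with assms(2) have le: "ereal lam
      \<le> ereal (n * (n - 1) / 4) * ((D_inf n R a + ereal (2 * \<omega>)) / ereal (2 * (n + 2)))"
    by (rule order_trans)
  show ?thesis
  proof (cases "D_inf n R a")
    case (real d)
    have "ereal (n * (n - 1) / 4) * ((ereal d + ereal (2 * \<omega>)) / ereal (2 * (n + 2)))
        = ereal (n * (n - 1) / 4 * ((d + 2 * \<omega>) / (2 * (n + 2))))"
      using assms(1) by simp
    then show ?thesis using that[OF real] le by (simp only: real ereal_less_eq)
  qed (use assms le in auto)
qed

theorem theorem1p2:
  fixes n R q \<omega> lam :: real and a :: "real \<Rightarrow> real"
  assumes "n > 2" and "R > 0" and "q = (n + 2) / (n - 2)" and "\<omega> \<ge> 0"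
    and "C_k_on 3 {0..R} a"
    and "a 0 = 0"
    and "\<And>x. x \<in> {0<..<R} \<Longrightarrow> nth_deriv_on {0..R} 1 a x > 0"
    and "\<And>x. x \<in> {0<..<R} \<Longrightarrow> nth_deriv_on {0..R} 2 a x \<ge> \<omega> * a x"
    and "ereal lam \<le> lambda_star n R \<omega> a"
  shows "\<not> (\<exists>u. bvp_solution n R q a lam u \<and> (\<exists>x\<in>{0..R}. u x \<noteq> 0))"
proof (intro notI, elim exE conjE bexE)
  fix u x assume bvp: "bvp_solution n R q a lam u" and x: "x \<in> {0..R}" "u x \<noteq> 0"
  note a_deriv = C_k_on_has_real_derivative[OF assms(5)]
  note u_C2 = bvp[unfolded bvp_solution_def, THEN conjunct1]
  note u_deriv = C_k_on_has_real_derivative[OF u_C2]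
  have q: "q - 1 = 2 * n / (n - 2) - 2" using assms(1,3) by (simp add: field_simps)
  interpret radial_bvp n R lam "2 * n / (n - 2)" a "nth_deriv_on {0..R} 1 a" "nth_deriv_on {0..R} 2 a"
    u "nth_deriv_on {0..R} 1 u" "nth_deriv_on {0..R} 2 u"
  proof
    show "continuous_on {0..R} a" "continuous_on {0..R} (nth_deriv_on {0..R} 1 a)"
      using C_k_on_continuous[OF assms(5), of 0] C_k_on_continuous[OF assms(5), of 1]
      by (simp_all add: nth_deriv_on_0)
    show "continuous_on {0..R} u" "continuous_on {0..R} (nth_deriv_on {0..R} 1 u)"
      using C_k_on_continuous[OF u_C2, of 0] C_k_on_continuous[OF u_C2, of 1]
      by (simp_all add: nth_deriv_on_0)
    fix x assume x: "0 < x" "x < R"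
    show "(a has_real_derivative nth_deriv_on {0..R} 1 a x) (at x)"
      "(nth_deriv_on {0..R} 1 a has_real_derivative nth_deriv_on {0..R} 2 a x) (at x)"
      using a_deriv[of 0 x] a_deriv[of 1 x] x by (simp_all add: nth_deriv_on_0 numeral_2_eq_2)
    show "(u has_real_derivative nth_deriv_on {0..R} 1 u x) (at x)"
      "(nth_deriv_on {0..R} 1 u has_real_derivative nth_deriv_on {0..R} 2 u x) (at x)"
      using u_deriv[of 0 x] u_deriv[of 1 x] x by (simp_all add: nth_deriv_on_0 numeral_2_eq_2)
    show "nth_deriv_on {0..R} 2 u x = - (n - 1) * (nth_deriv_on {0..R} 1 a x / a x) * nth_deriv_on {0..R} 1 u x
        - u x * (lam + \<bar>u x\<bar> powr (2 * n / (n - 2) - 2))"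
    proof -
      have solve: "v2 = - (n - 1) * B * v1 - v * (lam + W)"
        if "- v2 - (n - 1) * B * v1 = lam * v + W * v" for v v1 v2 B W :: real
        using that by (simp add: algebra_simps)
      have eq: "\<forall>x\<in>{0<..<R}. - nth_deriv_on {0..R} 2 u x
          - (n - 1) * (nth_deriv_on {0..R} 1 a x / a x) * nth_deriv_on {0..R} 1 u x
        = lam * u x + \<bar>u x\<bar> powr (2 * n / (n - 2) - 2) * u x"
        using bvp unfolding bvp_solution_def q by blast
      show ?thesis by (rule solve, rule bspec[OF eq]) (use x in simp)
    qed
  qed (use assms bvp in \<open>auto simp: bvp_solution_def\<close>)
  define f where "f = (\<lambda>x. (2 * n - 3) * (nth_deriv_on {0..R} 2 a x / a x)
    + nth_deriv_on {0..R} 3 a x / nth_deriv_on {0..R} 1 a x)"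
  have D_le: "D_inf n R a \<le> ereal (f x)" if "0 < x" "x < R" for x
    unfolding D_inf_def f_def using that by (intro INF_lower) auto
  \<comment> \<open>One interior point suffices: the infimum is at most a real value there.\<close>
  from D_le[of "R / 2"] have "D_inf n R a \<noteq> \<infinity>" using R by auto
  then obtain d where d: "D_inf n R a = ereal d"
      "lam \<le> n * (n - 1) / 4 * ((d + 2 * \<omega>) / (2 * (n + 2)))"
    using lam_le_of_le_lambda_star[OF n assms(9)] by metis
  have a2_ge: "d / (2 * n - 2) * a x \<le> nth_deriv_on {0..R} 2 a x" if "0 < x" "x < R" for x
  proof (rule second_deriv_ge_of_D_bound[OF n cont(1) _ a_deriv(1) _ assms(6)])
    show "continuous_on {0..R} (nth_deriv_on {0..R} 2 a)" using C_k_on_continuous[OF assms(5)] by simp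
    show "(nth_deriv_on {0..R} 2 a has_real_derivative nth_deriv_on {0..R} 3 a x) (at x)"
      if "0 < x" "x < R" for x
      using C_k_on_has_real_derivative[OF assms(5), of 2 x] that by (simp add: numeral_3_eq_3)
    show "d \<le> (2 * n - 3) * (nth_deriv_on {0..R} 2 a x / a x)
        + nth_deriv_on {0..R} 3 a x / nth_deriv_on {0..R} 1 a x" if "0 < x" "x < R" for x
      using D_le[OF that] d(1) by (simp add: f_def)
  qed (use that a_pos a1_pos in auto)
  define w where "w = max \<omega> (d / (2 * n - 2))"
  have "u x = 0"
  proof (rule solution_trivial[of w])
    show "w \<ge> 0" using assms(4) by (simp add: w_def)
    show "w * a x \<le> nth_deriv_on {0..R} 2 a x" if "0 < x" "x < R" for x
      using a2_ge[OF that] assms(8)[of x] that by (auto simp: w_def max_def)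
    \<comment> \<open>Both entries of the maximum count: \<open>d \<le> (2 * n - 2) * w\<close> and
      \<open>2 * \<omega> \<le> 2 * w\<close> add up to \<open>2 * n * w\<close>, which yields the
      threshold of \<open>solution_trivial\<close>.\<close>
    have "d \<le> (2 * n - 2) * w"
      using n mult_left_mono[of "d / (2 * n - 2)" w "2 * n - 2"] by (simp add: w_def)
    moreover have "\<omega> \<le> w" by (simp add: w_def)
    ultimately have "d + 2 * \<omega> \<le> 2 * n * w" by (simp add: algebra_simps)
    then have "n * (n - 1) / 4 * ((d + 2 * \<omega>) / (2 * (n + 2)))
        \<le> n * (n - 1) / 4 * (2 * n * w / (2 * (n + 2)))"
      using n by (intro mult_left_mono divide_right_mono) auto
    also have "\<dots> = n\<^sup>2 * (n - 1) / (4 * (n + 2)) * w"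
      using n by (simp add: field_simps power2_eq_square)
    finally show "lam \<le> n\<^sup>2 * (n - 1) / (4 * (n + 2)) * w" using d(2) by simp
  qed (fact x(1))
  with x(2) show False by simp
qed

end
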